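(* Let $A\subseteq B$ and $A'\subseteq B'$ be two ring extensions and let $\phi:B\to B'$ be a surjective ring homomorphism with $\phi^{-1}(A')=A$. Let $\mathcal{G}\subseteq\mathbf{F}_A(B)$ be upward closed in $\mathbf{F}_A(B)$, and let $\mathcal{G}':=\phi(\mathcal{G})=\{\phi(L)\mid L\in\mathcal{G}\}$. Let $\Psi:\mathrm{Mult}(A',B',\mathcal{G}')\to\mathrm{Mult}(A,B,\mathcal{G})$ be the map $\star\mapsto\star_\phi$, where $I^{\star_\phi}:=\phi^{-1}(\phi(I)^\star)$ for $I\in\mathcal{G}$. Then the following hold. (a) For every $\star\in\mathrm{Mult}(A,B,\mathcal{G})$, the map $\star^\phi:\mathcal{G}'\to\mathcal{G}'$, $I\mapsto\phi(\phi^{-1}(I)^\star)$, is a multiplicative operation on $(A',B',\mathcal{G}')$. (b) The map $\Phi:\mathrm{Mult}(A,B,\mathcal{G})\to\mathrm{Mult}(A',B',\mathcal{G}')$, $\star\mapsto\star^\phi$, is well-defined and order-preserving. (c) $\Phi\circ\Psi$ is the identity on $\mathrm{Mult}(A',B',\mathcal{G}')$; that is, $(\star_\phi)^\phi=\star$ for every $\star\in\mathrm{Mult}(A',B',\mathcal{G}')$. (d) If $\ker\phi\subseteq L$ for every $L\in\mathcal{G}$, then $\Psi\circ\Phi$ is the identity on $\mathrm{Mult}(A,B,\mathcal{G})$; that is, $(\sharp^\phi)_\phi=\sharp$ for every $\sharp\in\mathrm{Mult}(A,B,\mathcal{G})$.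
   Context: All rings are commutative with unit. For a ring extension $A\subseteq B$, $\mathbf{F}_A(B)$ is the set of $A$-submodules of $B$, ordered by inclusion; for $I\in\mathbf{F}_A(B)$ and $b\in B$, $(I:b):=\{x\in B\mid bx\in I\}$. A closure operation on a partially ordered set is an extensive, order-preserving, idempotent self-map. For $\mathcal{G}\subseteq\mathbf{F}_A(B)$, a multiplicative operation on $(A,B,\mathcal{G})$ is a closure operation $\star:\mathcal{G}\to\mathcal{G}$, $I\mapsto I^\star$, such that $(I:b)^\star\subseteq(I^\star:b)$ for all $I\in\mathcal{G}$, $b\in B$ with $(I:b)\in\mathcal{G}$. $\mathrm{Mult}(A,B,\mathcal{G})$ is the set of these, ordered by $\star_1\leq\star_2$ iff $I^{\star_1}\subseteq I^{\star_2}$ for all $I\in\mathcal{G}$. $\mathcal{G}$ is upward closed if $X\in\mathcal{G}$, $Y\in\mathbf{F}_A(B)$ and $X\subseteq Y$ imply $Y\in\mathcal{G}$. Under the hypotheses on $\phi$, $\phi(L)$ is an $A'$-submodule of $B'$ for every $L\in\mathbf{F}_A(B)$. The map $\Psi$ is well-defined: each $\star_\phi$ is a multiplicative operation on $(A,B,\mathcal{G})$. *)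

theory Defs
  imports "HOL-Algebra.Module" "HOL-Algebra.Subrings"
begin

text \<open>
  A ring extension \<open>A \<subseteq> B\<close> is given by a ring record \<open>B\<close> (a \<^const>\<open>cring\<close>) and a set \<open>A\<close> with
  \<open>subring A B\<close>; the zero ring is allowed.
\<close>

definition module_of_ext :: "('a, 'm) ring_scheme \<Rightarrow> ('a, 'a) module"
  where "module_of_ext B =
    \<lparr>carrier = carrier B, monoid.mult = monoid.mult B, one = one B, zero = zero B, add = add B,
     smult = monoid.mult B\<rparr>"

definition submodules_ext :: "'a set \<Rightarrow> ('a, 'm) ring_scheme \<Rightarrow> 'a set set"
  where "submodules_ext A B = {I. submodule I (B\<lparr>carrier := A\<rparr>) (module_of_ext B)}"

definition elem_colon :: "('a, 'm) ring_scheme \<Rightarrow> 'a set \<Rightarrow> 'a \<Rightarrow> 'a set"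
  where "elem_colon B I b = {x \<in> carrier B. b \<otimes>\<^bsub>B\<^esub> x \<in> I}"

text \<open>
  Self-maps of \<open>S\<close> are represented by extensional functions, so that equality of HOL functions is
  equality of maps on \<open>S\<close>.
\<close>

definition closure_operation :: "'a::order set \<Rightarrow> ('a \<Rightarrow> 'a) \<Rightarrow> bool"
  where "closure_operation S c \<longleftrightarrow>
    c \<in> S \<rightarrow>\<^sub>E S \<and> (\<forall>x\<in>S. x \<le> c x) \<and> mono_on S c \<and> (\<forall>x\<in>S. c (c x) = c x)"

definition Mult :: "'a set \<Rightarrow> ('a, 'm) ring_scheme \<Rightarrow> 'a set set \<Rightarrow> ('a set \<Rightarrow> 'a set) set"
  where "Mult A B G = {s. G \<subseteq> submodules_ext A B \<and> closure_operation G s \<and>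
    (\<forall>I\<in>G. \<forall>b\<in>carrier B. elem_colon B I b \<in> G \<longrightarrow>
      s (elem_colon B I b) \<subseteq> elem_colon B (s I) b)}"

definition Mult_le :: "'a set set \<Rightarrow> ('a set \<Rightarrow> 'a set) \<Rightarrow> ('a set \<Rightarrow> 'a set) \<Rightarrow> bool"
  where "Mult_le G s t \<longleftrightarrow> (\<forall>I\<in>G. s I \<subseteq> t I)"

definition upward_closed_in :: "'a::order set \<Rightarrow> 'a set \<Rightarrow> bool"
  where "upward_closed_in F G \<longleftrightarrow> (\<forall>X\<in>G. \<forall>Y\<in>F. X \<le> Y \<longrightarrow> Y \<in> G)"

definition preimage_in :: "('a, 'm) ring_scheme \<Rightarrow> ('a \<Rightarrow> 'b) \<Rightarrow> 'b set \<Rightarrow> 'a set"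
  where "preimage_in B \<phi> J = {x \<in> carrier B. \<phi> x \<in> J}"

text \<open>\<open>Psi_map B \<phi> G s\<close> is \<open>s\<^sub>\<phi>\<close>, where \<open>G\<close> is the family on the side of \<open>B\<close>.\<close>

definition Psi_map ::
    "('a, 'm) ring_scheme \<Rightarrow> ('a \<Rightarrow> 'b) \<Rightarrow> 'a set set \<Rightarrow> ('b set \<Rightarrow> 'b set) \<Rightarrow> 'a set \<Rightarrow> 'a set"
  where "Psi_map B \<phi> G s = (\<lambda>I\<in>G. preimage_in B \<phi> (s (\<phi> ` I)))"

text \<open>\<open>Phi_map B \<phi> G' s\<close> is \<open>s\<^sup>\<phi>\<close>, where \<open>G'\<close> is the family on the side of \<open>B'\<close>.\<close>

definition Phi_map ::
    "('a, 'm) ring_scheme \<Rightarrow> ('a \<Rightarrow> 'b) \<Rightarrow> 'b set set \<Rightarrow> ('a set \<Rightarrow> 'a set) \<Rightarrow> 'b set \<Rightarrow> 'b set"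
  where "Phi_map B \<phi> G' s = (\<lambda>I\<in>G'. \<phi> ` s (preimage_in B \<phi> I))"

lemma module_module_of_ext:
  assumes "cring B" and "subring A B"
  shows "module (B\<lparr>carrier := A\<rparr>) (module_of_ext B)"
proof -
  interpret B: cring B by fact
  have AB: "A \<subseteq> carrier B" using assms(2) by (rule subringE)
  show ?thesis
  proof (rule moduleI)
    show "cring (B\<lparr>carrier := A\<rparr>)"
      using B.subcring_iff[OF AB] B.subcringI'[OF assms(2)] by blast
    show "abelian_group (module_of_ext B)"
    proof (rule abelian_groupI)
      fix x assume "x \<in> carrier (module_of_ext B)"
      then show "\<exists>y\<in>carrier (module_of_ext B). y \<oplus>\<^bsub>module_of_ext B\<^esub> x = \<zero>\<^bsub>module_of_ext B\<^esub>"
        by (auto simp: module_of_ext_def intro: B.l_neg)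
    qed (simp_all add: module_of_ext_def B.a_ac)
  qed (use AB in \<open>auto simp: module_of_ext_def B.l_distr B.r_distr B.m_assoc subset_iff\<close>)
qed

lemma submodules_ext_iff:
  "I \<in> submodules_ext A B \<longleftrightarrow>
    subgroup I (add_monoid B) \<and> (\<forall>a\<in>A. \<forall>x\<in>I. a \<otimes>\<^bsub>B\<^esub> x \<in> I)"
  by (auto simp: submodules_ext_def module_of_ext_def submodule_def submodule_axioms_def
      subgroup_def a_inv_def m_inv_def)

lemma image_submodules_ext:
  assumes "cring B" and "cring B'"
    and hom: "\<phi> \<in> ring_hom B B'" and surj: "\<phi> ` carrier B = carrier B'"
    and A: "preimage_in B \<phi> A' = A" and A': "subring A' B'"
    and L: "L \<in> submodules_ext A B"
  shows "\<phi> ` L \<in> submodules_ext A' B'"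
proof -
  interpret ring_hom_cring B B' \<phi>
    using assms by (simp add: ring_hom_cring_def ring_hom_cring_axioms_def)
  have sub: "subgroup L (add_monoid B)" and sm: "\<And>a x. a \<in> A \<Longrightarrow> x \<in> L \<Longrightarrow> a \<otimes>\<^bsub>B\<^esub> x \<in> L"
    using L by (auto simp: submodules_ext_iff)
  have LB: "L \<subseteq> carrier B" using subgroup.subset[OF sub] by simp
  interpret ah: group_hom "add_monoid B" "add_monoid B'" \<phi>
    by (simp add: group_hom_def group_hom_axioms_def R.add.is_group S.add.is_group hom_def)
  have "subgroup (\<phi> ` L) (add_monoid B')" by (rule ah.subgroup_img_is_subgroup[OF sub])
  moreover have "a \<otimes>\<^bsub>B'\<^esub> \<phi> x \<in> \<phi> ` L" if "a \<in> A'" "x \<in> L" for a x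
  proof -
    have "a \<in> carrier B'" using subringE(1)[OF A'] that by blast
    then obtain c where c: "c \<in> carrier B" "\<phi> c = a" using surj by (metis imageE)
    then have "c \<in> A" using A that by (auto simp: preimage_in_def)
    then have "\<phi> (c \<otimes>\<^bsub>B\<^esub> x) \<in> \<phi> ` L" using sm that by blast
    then show ?thesis using c that LB by (auto simp: subset_iff)
  qed
  ultimately show ?thesis by (auto simp: submodules_ext_iff)
qed

lemma preimage_submodules_ext:
  assumes "cring B" and "cring B'"
    and hom: "\<phi> \<in> ring_hom B B'" and A: "preimage_in B \<phi> A' = A"
    and L: "L \<in> submodules_ext A' B'"
  shows "preimage_in B \<phi> L \<in> submodules_ext A B"
proof -
  interpret ring_hom_cring B B' \<phi>
    using assms by (simp add: ring_hom_cring_def ring_hom_cring_axioms_def)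
  have sub: "subgroup L (add_monoid B')" and sm: "\<And>a x. a \<in> A' \<Longrightarrow> x \<in> L \<Longrightarrow> a \<otimes>\<^bsub>B'\<^esub> x \<in> L"
    using L by (auto simp: submodules_ext_iff)
  have "subgroup (preimage_in B \<phi> L) (add_monoid B)"
  proof (rule R.add.subgroupI)
    have "\<zero>\<^bsub>B\<^esub> \<in> preimage_in B \<phi> L"
      using subgroup.one_closed[OF sub] by (simp add: preimage_in_def)
    then show "preimage_in B \<phi> L \<noteq> {}" by blast
  qed (use subgroup.m_closed[OF sub] subgroup.m_inv_closed[OF sub, folded a_inv_def]
      in \<open>auto simp: preimage_in_def\<close>)
  then show ?thesis using A sm by (auto simp: submodules_ext_iff preimage_in_def)
qed

text \<open>The map \<open>\<Psi>\<close> is well defined.\<close>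

lemma Psi_map_Mult:
  assumes B: "cring B" and B': "cring B'" and A': "subring A' B'"
    and hom: "\<phi> \<in> ring_hom B B'" and surj: "\<phi> ` carrier B = carrier B'"
    and A: "preimage_in B \<phi> A' = A"
    and G: "G \<subseteq> submodules_ext A B" and up: "upward_closed_in (submodules_ext A B) G"
    and G': "G' = (\<lambda>L. \<phi> ` L) ` G"
    and s: "s \<in> Mult A' B' G'"
  shows "Psi_map B \<phi> G s \<in> Mult A B G"
proof -
  have sub: "I \<subseteq> carrier B" if "I \<in> G" for I
    using G that subgroup.subset[of I "add_monoid B"] submodules_ext_iff[of I A B] by auto
  have sE: "s J \<in> G'" "J \<subseteq> s J" "s (s J) = s J" if "J \<in> G'" for J
    using s that by (auto simp: Mult_def closure_operation_def)
  have smono: "s J \<subseteq> s K" if "J \<in> G'" "K \<in> G'" "J \<subseteq> K" for J K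
    using s that by (auto simp: Mult_def closure_operation_def monotone_on_def)
  have smul: "s (elem_colon B' J b) \<subseteq> elem_colon B' (s J) b"
    if "J \<in> G'" "b \<in> carrier B'" "elem_colon B' J b \<in> G'" for J b
    using s that by (auto simp: Mult_def)
  have im: "\<phi> ` I \<in> G'" if "I \<in> G" for I using G' that by blast
  have G'F: "G' \<subseteq> submodules_ext A' B'" using s by (auto simp: Mult_def)
  have img: "\<phi> ` preimage_in B \<phi> J = J" if "J \<in> G'" for J
  proof -
    have "J \<subseteq> carrier B'"
      using G'F that subgroup.subset[of J "add_monoid B'"] submodules_ext_iff[of J A' B'] by auto
    then show ?thesis using surj by (fastforce simp: preimage_in_def)
  qed
  have pre: "preimage_in B \<phi> J \<in> G" if J: "J \<in> G'" for J
  proof -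
    obtain L where L: "L \<in> G" "J = \<phi> ` L" using G' J by blast
    have "L \<subseteq> preimage_in B \<phi> J" using L sub by (auto simp: preimage_in_def)
    moreover have "preimage_in B \<phi> J \<in> submodules_ext A B"
      using preimage_submodules_ext[OF B B' hom A] G'F J by blast
    ultimately show ?thesis using up L by (auto simp: upward_closed_in_def)
  qed
  have ext: "I \<subseteq> preimage_in B \<phi> (s (\<phi> ` I))" if "I \<in> G" for I
    using sub[OF that] sE(2)[OF im[OF that]] by (auto simp: preimage_in_def)
  have mono: "preimage_in B \<phi> (s (\<phi> ` I)) \<subseteq> preimage_in B \<phi> (s (\<phi> ` K))"
    if "I \<in> G" "K \<in> G" "I \<subseteq> K" for I K
    using smono[OF im[OF that(1)] im[OF that(2)] image_mono[OF that(3)]]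
    by (auto simp: preimage_in_def)
  have mul: "preimage_in B \<phi> (s (\<phi> ` elem_colon B I b))
      \<subseteq> elem_colon B (preimage_in B \<phi> (s (\<phi> ` I))) b"
    if I: "I \<in> G" and b: "b \<in> carrier B" and c: "elem_colon B I b \<in> G" for I b
  proof -
    have bB: "\<phi> b \<in> carrier B'" using hom b by (rule ring_hom_closed)
    let ?K = "elem_colon B' (\<phi> ` I) (\<phi> b)"
    have sK: "\<phi> ` elem_colon B I b \<subseteq> ?K"
      using b by (auto simp: elem_colon_def ring_hom_closed[OF hom]
          ring_hom_mult[OF hom, symmetric])
    interpret ring_hom_cring B B' \<phi>
      using B B' hom by (simp add: ring_hom_cring_def ring_hom_cring_axioms_def)
    have I': "subgroup (\<phi> ` I) (add_monoid B')"
        "\<And>a x. a \<in> A' \<Longrightarrow> x \<in> \<phi> ` I \<Longrightarrow> a \<otimes>\<^bsub>B'\<^esub> x \<in> \<phi> ` I"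
      using im[OF I] G'F submodules_ext_iff[of "\<phi> ` I" A' B'] by blast+
    have I'B: "\<phi> ` I \<subseteq> carrier B'" using subgroup.subset[OF I'(1)] by simp
    have "?K \<in> submodules_ext A' B'"
    proof -
      have "subgroup ?K (add_monoid B')"
      proof (rule S.add.subgroupI)
        show "?K \<subseteq> carrier B'" by (auto simp: elem_colon_def)
        have "\<zero>\<^bsub>B'\<^esub> \<in> ?K"
          using bB subgroup.one_closed[OF I'(1)] by (auto simp: elem_colon_def)
        then show "?K \<noteq> {}" by blast
        show "\<ominus>\<^bsub>B'\<^esub> x \<in> ?K" if "x \<in> ?K" for x
          using bB that subgroup.m_inv_closed[OF I'(1), folded a_inv_def]
          by (auto simp: elem_colon_def S.r_minus)
        show "x \<oplus>\<^bsub>B'\<^esub> y \<in> ?K" if "x \<in> ?K" "y \<in> ?K" for x y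
          using bB that subgroup.m_closed[OF I'(1)]
          by (auto simp: elem_colon_def S.r_distr)
      qed
      moreover have "a \<otimes>\<^bsub>B'\<^esub> x \<in> ?K" if "a \<in> A'" "x \<in> ?K" for a x
        using bB that I'(2) subringE(1)[OF A']
        by (auto simp: elem_colon_def S.m_lcomm subset_iff)
      ultimately show ?thesis by (auto simp: submodules_ext_iff)
    qed
    then have "preimage_in B \<phi> ?K \<in> submodules_ext A B"
      by (rule preimage_submodules_ext[OF B B' hom A])
    moreover have "elem_colon B I b \<subseteq> preimage_in B \<phi> ?K"
      using sK by (auto simp: preimage_in_def elem_colon_def)
    ultimately have "preimage_in B \<phi> ?K \<in> G"
      using up c by (auto simp: upward_closed_in_def)
    moreover have "\<phi> ` preimage_in B \<phi> ?K = ?K"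
      using surj by (fastforce simp: preimage_in_def elem_colon_def)
    ultimately have KG: "?K \<in> G'" using im by metis
    have "s (\<phi> ` elem_colon B I b) \<subseteq> elem_colon B' (s (\<phi> ` I)) (\<phi> b)"
      using smono[OF im[OF c] KG sK] smul[OF im[OF I] bB KG] by blast
    then show ?thesis using b by (auto simp: preimage_in_def elem_colon_def)
  qed
  have idem: "preimage_in B \<phi> (s (\<phi> ` preimage_in B \<phi> (s (\<phi> ` I)))) = preimage_in B \<phi> (s (\<phi> ` I))"
    if "I \<in> G" for I
    using img sE im that by simp
  let ?p = "Psi_map B \<phi> G s"
  have p: "?p I = preimage_in B \<phi> (s (\<phi> ` I))" if "I \<in> G" for I
    using that by (simp add: Psi_map_def)
  have pG: "preimage_in B \<phi> (s (\<phi> ` I)) \<in> G" if "I \<in> G" for I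
    using pre sE(1) im that by blast
  have "?p \<in> G \<rightarrow>\<^sub>E G"
    using pG by (simp add: Psi_map_def)
  moreover have "mono_on G ?p"
    using mono by (intro monotone_onI) (simp add: p)
  ultimately show ?thesis
    using G ext mul idem pG by (simp add: Mult_def closure_operation_def p)
qed

end

theory Submission
  imports Defs
begin

text \<open>
  Taking images and taking preimages under \<open>\<phi>\<close> are inverse to each other between the
  \<open>A'\<close>-submodules of \<open>B'\<close> and the \<open>A\<close>-submodules of \<open>B\<close> that contain \<open>ker \<phi>\<close>: surjectivity gives
  \<open>\<phi>(\<phi>\<^sup>-\<^sup>1(J)) = J\<close> (\<open>image_preimage\<close>), and \<open>\<phi>\<^sup>-\<^sup>1(\<phi>(J)) = J + ker \<phi>\<close> equals \<open>J\<close> as soon as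
  \<open>ker \<phi> \<subseteq> J\<close> (\<open>preimage_image\<close>). Upward closedness makes this correspondence
  respect the families: for \<open>J = \<phi>(L)\<close> with \<open>L \<in> G\<close>, the submodule \<open>\<phi>\<^sup>-\<^sup>1(J) \<supseteq> L\<close> lies in \<open>G\<close>.

  A multiplicative operation \<open>s\<close> on \<open>G\<close> moves every preimage \<open>\<phi>\<^sup>-\<^sup>1(J)\<close> to a larger submodule,
  which again contains \<open>ker \<phi>\<close>. So \<open>s\<close> restricts to the part of \<open>G\<close> above \<open>ker \<phi>\<close>, and
  \<open>s\<^sup>\<phi>\<close> is this restriction transported along the correspondence; this is why it is a closure
  operation. The condition on colons is transported too, because \<open>\<phi>\<^sup>-\<^sup>1(J : \<phi>(b)) = (\<phi>\<^sup>-\<^sup>1(J) : b)\<close>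
  and every element of \<open>B'\<close> is some \<open>\<phi>(b)\<close>. Going from \<open>G'\<close> to \<open>G\<close> and back loses nothing,
  since the image of \<open>\<phi>\<^sup>-\<^sup>1(s(J))\<close> is \<open>s(J)\<close>. Going from \<open>G\<close> to \<open>G'\<close> and back forgets what the
  operation does to members of \<open>G\<close> that do not contain \<open>ker \<phi>\<close>, and nothing else.
\<close>

lemma submodules_ext_subset_carrier:
  assumes "L \<in> submodules_ext A B"
  shows "L \<subseteq> carrier B"
  using assms subgroup.subset[of L "add_monoid B"] by (auto simp: submodules_ext_iff)

lemma image_preimage:
  assumes "\<phi> ` carrier B = carrier B'" and "J \<subseteq> carrier B'"
  shows "\<phi> ` preimage_in B \<phi> J = J"
  using assms by (fastforce simp: preimage_in_def)

text \<open>If \<open>h x = h y\<close> with \<open>y \<in> L\<close>, then \<open>x - y\<close> is in the kernel, hence in \<open>L\<close>, and so is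
  \<open>x = (x - y) + y\<close>.\<close>

lemma (in ring_hom_cring) preimage_image:
  assumes L: "subgroup L (add_monoid R)" and ker: "a_kernel R S h \<subseteq> L"
  shows "preimage_in R h (h ` L) = L"
proof
  have LR: "L \<subseteq> carrier R" using subgroup.subset[OF L] by simp
  then show "L \<subseteq> preimage_in R h (h ` L)" by (auto simp: preimage_in_def)
  show "preimage_in R h (h ` L) \<subseteq> L"
  proof
    fix x assume "x \<in> preimage_in R h (h ` L)"
    then obtain y where x: "x \<in> carrier R" and y: "y \<in> L" and eq: "h x = h y"
      by (auto simp: preimage_in_def)
    have yR: "y \<in> carrier R" using y LR by blast
    have "h (x \<ominus>\<^bsub>R\<^esub> y) = \<zero>\<^bsub>S\<^esub>"
      using x yR eq by (simp add: R.minus_eq S.r_neg)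
    then have "x \<ominus>\<^bsub>R\<^esub> y \<in> a_kernel R S h"
      using x yR unfolding a_kernel_def' by simp
    then have "(x \<ominus>\<^bsub>R\<^esub> y) \<oplus>\<^bsub>R\<^esub> y \<in> L"
      using ker y subgroup.m_closed[OF L] by auto
    then show "x \<in> L"
      using x yR by (simp add: R.minus_eq R.a_assoc R.l_neg)
  qed
qed

lemma (in ring_hom_cring) a_kernel_subset_preimage:
  assumes "subgroup J (add_monoid S)"
  shows "a_kernel R S h \<subseteq> preimage_in R h J"
  using subgroup.one_closed[OF assms] unfolding a_kernel_def' by (auto simp: preimage_in_def)

lemma (in ring_hom_cring) preimage_elem_colon:
  assumes "b \<in> carrier R"
  shows "preimage_in R h (elem_colon S J (h b)) = elem_colon R (preimage_in R h J) b"
  using assms by (auto simp: preimage_in_def elem_colon_def)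

lemma (in ring_hom_cring) image_elem_colon_subset:
  assumes "b \<in> carrier R"
  shows "h ` elem_colon R J b \<subseteq> elem_colon S (h ` J) (h b)"
  using assms by (auto simp: elem_colon_def simp flip: hom_mult)

locale surjective_extension_hom = ring_hom_cring B B' \<phi>
  for B :: "('a, 'm) ring_scheme" and B' :: "('b, 'n) ring_scheme" and \<phi> :: "'a \<Rightarrow> 'b" +
  fixes A :: "'a set" and A' :: "'b set" and G :: "'a set set" and G' :: "'b set set"
  assumes subring': "subring A' B'"
    and surj: "\<phi> ` carrier B = carrier B'"
    and A_eq: "preimage_in B \<phi> A' = A"
    and G_sub: "G \<subseteq> submodules_ext A B"
    and up: "upward_closed_in (submodules_ext A B) G"
    and G'_eq: "G' = (\<lambda>L. \<phi> ` L) ` G"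
begin

lemma G'_sub: "G' \<subseteq> submodules_ext A' B'"
  using image_submodules_ext[OF R.is_cring S.is_cring homh surj A_eq subring'] G_sub G'_eq by blast

lemma G_subgroup: "L \<in> G \<Longrightarrow> subgroup L (add_monoid B)"
  using G_sub submodules_ext_iff by blast

lemma G'_subgroup: "J \<in> G' \<Longrightarrow> subgroup J (add_monoid B')"
  using G'_sub submodules_ext_iff by blast

lemma image_in_G': "L \<in> G \<Longrightarrow> \<phi> ` L \<in> G'"
  using G'_eq by blast

lemma image_preimage_G': "J \<in> G' \<Longrightarrow> \<phi> ` preimage_in B \<phi> J = J"
  by (rule image_preimage[OF surj submodules_ext_subset_carrier[OF subsetD[OF G'_sub]]])

lemma preimage_in_G:
  assumes "J \<in> G'"
  shows "preimage_in B \<phi> J \<in> G"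
proof -
  obtain L where L: "L \<in> G" "J = \<phi> ` L" using assms G'_eq by blast
  have "L \<subseteq> carrier B" using L(1) G_sub submodules_ext_subset_carrier by blast
  then have "L \<subseteq> preimage_in B \<phi> J"
    using L(2) by (auto simp: preimage_in_def)
  moreover have "preimage_in B \<phi> J \<in> submodules_ext A B"
    using preimage_submodules_ext[OF R.is_cring S.is_cring homh A_eq] assms G'_sub by blast
  ultimately show ?thesis using up L(1) by (auto simp: upward_closed_in_def)
qed

text \<open>\<open>s (\<phi>\<^sup>-\<^sup>1(J))\<close> contains \<open>\<phi>\<^sup>-\<^sup>1(J)\<close> and therefore the kernel; so no information is lost when it
  is replaced by its image. Idempotence of \<open>s\<^sup>\<phi>\<close> rests on this.\<close>

lemma preimage_image_closure:
  assumes "s \<in> Mult A B G" and "J \<in> G'"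
  shows "preimage_in B \<phi> (\<phi> ` s (preimage_in B \<phi> J)) = s (preimage_in B \<phi> J)"
proof (rule preimage_image)
  have "s (preimage_in B \<phi> J) \<in> G" and le: "preimage_in B \<phi> J \<subseteq> s (preimage_in B \<phi> J)"
    using assms(1) preimage_in_G[OF assms(2)] by (auto simp: Mult_def closure_operation_def)
  then show "subgroup (s (preimage_in B \<phi> J)) (add_monoid B)" by (simp add: G_subgroup)
  show "a_kernel B B' \<phi> \<subseteq> s (preimage_in B \<phi> J)"
    using a_kernel_subset_preimage[OF G'_subgroup[OF assms(2)]] le by blast
qed

lemma Phi_map_Mult:
  assumes s: "s \<in> Mult A B G"
  shows "Phi_map B \<phi> G' s \<in> Mult A' B' G'"
proof -
  let ?pre = "preimage_in B \<phi>"
  let ?p = "Phi_map B \<phi> G' s"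
  have sG: "s L \<in> G" "L \<subseteq> s L" "s (s L) = s L" if "L \<in> G" for L
    using s that by (auto simp: Mult_def closure_operation_def)
  have smono: "s K \<subseteq> s L" if "K \<in> G" "L \<in> G" "K \<subseteq> L" for K L
    using s that by (auto simp: Mult_def closure_operation_def monotone_on_def)
  have scolon: "s (elem_colon B L b) \<subseteq> elem_colon B (s L) b"
    if "L \<in> G" "b \<in> carrier B" "elem_colon B L b \<in> G" for L b
    using s that by (auto simp: Mult_def)
  have p: "?p J = \<phi> ` s (?pre J)" if "J \<in> G'" for J
    using that by (simp add: Phi_map_def)
  have pG: "?p J \<in> G'" if "J \<in> G'" for J
    using that p image_in_G' sG(1) preimage_in_G by simp
  have ext: "J \<subseteq> ?p J" if "J \<in> G'" for J
    using image_mono[OF sG(2)[OF preimage_in_G[OF that]], of \<phi>] image_preimage_G'[OF that] p[OF that]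
    by simp
  have mono: "mono_on G' ?p"
  proof (rule monotone_onI)
    fix J K assume JK: "J \<in> G'" "K \<in> G'" "J \<subseteq> K"
    then have "?pre J \<subseteq> ?pre K" by (auto simp: preimage_in_def)
    then have "s (?pre J) \<subseteq> s (?pre K)" using smono preimage_in_G JK by blast
    then show "?p J \<subseteq> ?p K" using JK by (simp add: p image_mono)
  qed
  have idem: "?p (?p J) = ?p J" if "J \<in> G'" for J
  proof -
    have "?p (?p J) = \<phi> ` s (?pre (\<phi> ` s (?pre J)))"
      using p[OF pG[OF that]] p[OF that] by simp
    also have "\<dots> = \<phi> ` s (?pre J)"
      using preimage_image_closure[OF s that] sG(3)[OF preimage_in_G[OF that]] by simp
    finally show ?thesis using p[OF that] by simp
  qed
  have colon: "?p (elem_colon B' J b') \<subseteq> elem_colon B' (?p J) b'"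
    if J: "J \<in> G'" and b': "b' \<in> carrier B'" and c: "elem_colon B' J b' \<in> G'" for J b'
  proof -
    obtain b where b: "b \<in> carrier B" "b' = \<phi> b" using b' surj by blast
    have pre: "?pre (elem_colon B' J b') = elem_colon B (?pre J) b"
      using preimage_elem_colon b by simp
    have "s (elem_colon B (?pre J) b) \<subseteq> elem_colon B (s (?pre J)) b"
      using scolon[OF preimage_in_G[OF J] b(1)] preimage_in_G[OF c] pre by simp
    then have "\<phi> ` s (elem_colon B (?pre J) b) \<subseteq> elem_colon B' (\<phi> ` s (?pre J)) b'"
      using image_elem_colon_subset[OF b(1), of "s (?pre J)"] b(2) by blast
    then show ?thesis using p J c pre by simp
  qed
  have "?p \<in> G' \<rightarrow>\<^sub>E G'"
    using pG by (auto simp: Phi_map_def)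
  then show ?thesis
    using G'_sub ext mono idem colon by (simp add: Mult_def closure_operation_def)
qed

lemma Phi_map_mono:
  "monotone_on (Mult A B G) (Mult_le G) (Mult_le G') (Phi_map B \<phi> G')"
  using preimage_in_G by (intro monotone_onI) (auto simp: Mult_le_def Phi_map_def)

lemma Phi_map_Psi_map:
  assumes "s \<in> Mult A' B' G'"
  shows "Phi_map B \<phi> G' (Psi_map B \<phi> G s) = s"
proof (rule extensionalityI)
  show "Phi_map B \<phi> G' (Psi_map B \<phi> G s) \<in> extensional G'" by (simp add: Phi_map_def)
  have s: "s \<in> G' \<rightarrow>\<^sub>E G'" using assms by (simp add: Mult_def closure_operation_def)
  then show "s \<in> extensional G'" by (simp add: PiE_def)
  show "Phi_map B \<phi> G' (Psi_map B \<phi> G s) J = s J" if "J \<in> G'" for J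
  proof -
    have "s J \<in> G'" using s that by blast
    then show ?thesis
      using that by (simp add: Phi_map_def Psi_map_def preimage_in_G image_preimage_G')
  qed
qed

lemma Psi_map_Phi_map:
  assumes ker: "\<forall>L\<in>G. a_kernel B B' \<phi> \<subseteq> L" and "t \<in> Mult A B G"
  shows "Psi_map B \<phi> G (Phi_map B \<phi> G' t) = t"
proof (rule extensionalityI)
  show "Psi_map B \<phi> G (Phi_map B \<phi> G' t) \<in> extensional G" by (simp add: Psi_map_def)
  have t: "t \<in> G \<rightarrow>\<^sub>E G" using assms(2) by (simp add: Mult_def closure_operation_def)
  then show "t \<in> extensional G" by (simp add: PiE_def)
  have pre: "preimage_in B \<phi> (\<phi> ` L) = L" if "L \<in> G" for L
    using that ker by (simp add: preimage_image G_subgroup)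
  show "Psi_map B \<phi> G (Phi_map B \<phi> G' t) L = t L" if "L \<in> G" for L
  proof -
    have "t L \<in> G" using t that by blast
    then show ?thesis
      using that by (simp add: Phi_map_def Psi_map_def pre image_in_G')
  qed
qed

end

theorem proposition5p4:
  fixes B :: "('a, 'm) ring_scheme" and B' :: "('b, 'n) ring_scheme"
    and A :: "'a set" and A' :: "'b set"
    and \<phi> :: "'a \<Rightarrow> 'b"
    and G :: "'a set set" and G' :: "'b set set"
  assumes "cring B" and "subring A B"
    and "cring B'" and "subring A' B'"
    and "\<phi> \<in> ring_hom B B'" and "\<phi> ` carrier B = carrier B'"
    and "preimage_in B \<phi> A' = A"
    and "G \<subseteq> submodules_ext A B"
    and "upward_closed_in (submodules_ext A B) G"
    and "G' = (\<lambda>L. \<phi> ` L) ` G"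
  shows "((\<forall>I\<in>G'. preimage_in B \<phi> I \<in> G) \<and>
        (\<forall>s\<in>Mult A B G. Phi_map B \<phi> G' s \<in> Mult A' B' G')) \<and>
      (Phi_map B \<phi> G' \<in> Mult A B G \<rightarrow> Mult A' B' G' \<and>
        monotone_on (Mult A B G) (Mult_le G) (Mult_le G') (Phi_map B \<phi> G')) \<and>
      (\<forall>s\<in>Mult A' B' G'. Phi_map B \<phi> G' (Psi_map B \<phi> G s) = s) \<and>
      ((\<forall>L\<in>G. a_kernel B B' \<phi> \<subseteq> L) \<longrightarrow>
        (\<forall>t\<in>Mult A B G. Psi_map B \<phi> G (Phi_map B \<phi> G' t) = t))"
proof -
  interpret surjective_extension_hom B B' \<phi> A A' G G'
    using assms by (simp add: surjective_extension_hom_def surjective_extension_hom_axioms_def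
        ring_hom_cring_def ring_hom_cring_axioms_def)
  show ?thesis
    using preimage_in_G Phi_map_Mult Phi_map_mono Phi_map_Psi_map Psi_map_Phi_map by blast
qed

end
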